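(* Let $X$ be a real Hilbert space and let $f$ and $g$ be in $\Gamma_0(X)$. Then the following are equivalent: (i) $P_f\preceq P_g$, i.e., $P_g-P_f\in\mathcal{F}(X)$. (ii) $P_g-P_f\in\mathcal{P}(X)$. (iii) $\operatorname{env}(g^* )-\operatorname{env}(f^* )\in M_0(X)$. (iv) $\operatorname{env}(f)-\operatorname{env}(g)\in M_0(X)$.
   Context: $X$ is a real Hilbert space with inner product $\langle\cdot,\cdot\rangle$ and induced norm $\|\cdot\|$. $\Gamma_0(X)$ is the set of all convex, lower semicontinuous, proper functions $X\to\mathbb{R}\cup\{+\infty\}$. $f^*$ is the Fenchel conjugate of $f$. Set $q(x)=\tfrac12\|x\|^2$. For $f\in\Gamma_0(X)$, the (Moreau) envelope is $\operatorname{env}(f)=q\,\square\, f$, i.e. $\operatorname{env}(f)(x)=\inf_{y\in X}\big(f(y)+\tfrac12\|x-y\|^2\big)$, and $M_0(X)=\{\operatorname{env}(f): f\in\Gamma_0(X)\}$. The proximal mapping of $f$ is $P_f=(\operatorname{Id}+\partial f)^{-1}\colon X\to X$, where $\partial f$ is the subdifferential, and $\mathcal{P}(X)=\{P_f : f\in\Gamma_0(X)\}$ is the set of proximal mappings. $\mathcal{F}(X)$ is the set of firmly nonexpansive mappings, i.e. $T\colon X\to X$ with $\|Tx-Ty\|^2\le\langle x-y,Tx-Ty\rangle$ for all $x,y\in X$; one has $\mathcal{P}(X)\subseteq\mathcal{F}(X)$. The resolvent order on $\mathcal{F}(X)$ is $T_1\preceq T_2 :\Leftrightarrow T_2-T_1\in\mathcal{F}(X)$.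 *)

theory Defs
  imports "HOL-Analysis.Analysis"
begin

text \<open>
  A real Hilbert space is a type of sort \<open>{real_inner, complete_space}\<close>. Functions
  \<open>X \<rightarrow> \<real> \<union> {+\<infinity>}\<close> are \<^typ>\<open>ereal\<close>-valued; \<open>proper\<close> excludes the value \<open>-\<infinity>\<close>.
\<close>

definition proper :: "('a \<Rightarrow> ereal) \<Rightarrow> bool" where
  "proper f \<longleftrightarrow> (\<forall>x. f x \<noteq> -\<infinity>) \<and> (\<exists>x. f x \<noteq> \<infinity>)"

text \<open>The library's \<^const>\<open>convex_on\<close> covers real-valued functions only. The inequality is
  meant for functions that avoid \<open>-\<infinity>\<close>, so that \<open>\<infinity> - \<infinity>\<close> does not arise.\<close>

definition convex_ext :: "('a::real_vector \<Rightarrow> ereal) \<Rightarrow> bool" where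
  "convex_ext f \<longleftrightarrow>
     (\<forall>x y. \<forall>t\<in>{0<..<1::real}.
        f ((1 - t) *\<^sub>R x + t *\<^sub>R y) \<le> ereal (1 - t) * f x + ereal t * f y)"

definition lower_semicont :: "('a::topological_space \<Rightarrow> ereal) \<Rightarrow> bool" where
  "lower_semicont f \<longleftrightarrow> (\<forall>x. f x \<le> Liminf (nhds x) f)"

definition Gamma0 :: "('a::{real_inner,complete_space} \<Rightarrow> ereal) set" where
  "Gamma0 = {f. convex_ext f \<and> lower_semicont f \<and> proper f}"

definition fenchel_conj :: "('a::real_inner \<Rightarrow> ereal) \<Rightarrow> 'a \<Rightarrow> ereal" where
  "fenchel_conj f u = (SUP x. ereal (x \<bullet> u) - f x)"

definition env :: "('a::real_inner \<Rightarrow> ereal) \<Rightarrow> 'a \<Rightarrow> ereal" where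
  "env f x = (INF y. f y + ereal ((norm (x - y))\<^sup>2 / 2))"

definition M0 :: "('a::{real_inner,complete_space} \<Rightarrow> ereal) set" where
  "M0 = env ` Gamma0"

definition subdifferential :: "('a::real_inner \<Rightarrow> ereal) \<Rightarrow> 'a \<Rightarrow> 'a set" where
  "subdifferential f x = {u. \<forall>y. f x + ereal ((y - x) \<bullet> u) \<le> f y}"

text \<open>The set \<open>(+) p ` subdifferential f p\<close> is \<open>(Id + \<partial>f)(p)\<close>, so \<open>prox f x\<close> is the value of
  the inverse of \<open>Id + \<partial>f\<close> at \<open>x\<close>. By Minty's theorem that inverse is single-valued and
  everywhere defined for \<open>f\<close> in \<^const>\<open>Gamma0\<close>; for other \<open>f\<close> the description may be
  unspecified.\<close>

definition prox :: "('a::real_inner \<Rightarrow> ereal) \<Rightarrow> 'a \<Rightarrow> 'a" where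
  "prox f x = (THE p. x \<in> (+) p ` subdifferential f p)"

definition prox_maps :: "('a::{real_inner,complete_space} \<Rightarrow> 'a) set" where
  "prox_maps = prox ` Gamma0"

definition firmly_nonexpansive :: "('a::real_inner \<Rightarrow> 'a) set" where
  "firmly_nonexpansive =
     {T. \<forall>x y. (norm (T x - T y))\<^sup>2 \<le> (x - y) \<bullet> (T x - T y)}"

definition resolvent_le :: "('a::real_inner \<Rightarrow> 'a) \<Rightarrow> ('a \<Rightarrow> 'a) \<Rightarrow> bool"
    (infix "\<preceq>\<^sub>R" 50) where
  "T1 \<preceq>\<^sub>R T2 \<longleftrightarrow> (\<lambda>x. T2 x - T1 x) \<in> firmly_nonexpansive"

end

theory Submission
  imports Defs
begin

text \<open>
  Everything reduces to the single real function \<open>h = env f - env g\<close>. For \<open>f\<close> in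
  \<^const>\<open>Gamma0\<close>, the envelope is finite and differentiable with gradient
  \<open>x - prox f x\<close> (lemma \<open>env_GDERIV\<close>), so \<open>h\<close> has gradient \<open>T = prox g - prox f\<close>,
  the very map that the resolvent order asks to be firmly nonexpansive.

  Moreau's decomposition says that \<open>env f\<close> and the envelope of the conjugate of \<open>f\<close> add up to
  half the squared norm, and that the two proximal maps add up to the identity (lemmas
  \<open>env_fenchel_conj\<close> and \<open>prox_fenchel_conj\<close>). Hence the difference of the conjugate
  envelopes is again \<open>h\<close>, and the two statements about envelopes are the same statement.

  If \<open>T\<close> is a proximal map, it is firmly nonexpansive, since subdifferentials are monotone. If
  \<open>h = env k\<close>, comparison of gradients shows that \<open>T\<close> is \<open>Id - prox k\<close>, the proximal map
  of the conjugate of \<open>k\<close>.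

  The substance is the converse: a firmly nonexpansive gradient \<open>T\<close> of \<open>h\<close> comes from an
  envelope (lemma \<open>firmly_nonexpansive_gradient_is_env\<close>). If \<open>h = env k\<close> were known, then
  \<open>T x\<close> would be a subgradient of \<open>k\<close> at \<open>x - T x\<close>, where \<open>k\<close> takes the value
  \<open>h x - \<parallel>T x\<parallel>\<^sup>2 / 2\<close>. So define \<open>k\<close> as the supremum of the affine functions that
  these data prescribe. Each of them attains the supremum at its own base point precisely when
  \<open>h z \<ge> h x + (z - x) \<bullet> T x + \<parallel>T z - T x\<parallel>\<^sup>2 / 2\<close> for all \<open>x\<close> and \<open>z\<close>, which
  is the Baillon-Haddad inequality (lemma \<open>firmly_nonexpansive_gradient_lower_bound\<close>).
\<close>

section \<open>Proximal points\<close>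

lemma Gamma0D:
  assumes "f \<in> Gamma0"
  shows "convex_ext f" "lower_semicont f" "proper f"
  using assms by (auto simp: Gamma0_def)

lemma proper_not_MInf: "proper f \<Longrightarrow> f x \<noteq> -\<infinity>"
  by (simp add: proper_def)

lemma subdifferentialD:
  "u \<in> subdifferential f p \<Longrightarrow> f p + ereal ((y - p) \<bullet> u) \<le> f y"
  by (simp add: subdifferential_def)

lemma subdifferential_imp_finite:
  assumes "proper f" "u \<in> subdifferential f p"
  obtains r where "f p = ereal r"
proof -
  obtain y where y: "f y \<noteq> \<infinity>" using assms(1) by (auto simp: proper_def)
  have "f p + ereal ((y - p) \<bullet> u) \<le> f y"
    using assms(2) by (rule subdifferentialD)
  with y have "f p \<noteq> \<infinity>" by auto
  moreover have "f p \<noteq> -\<infinity>" using assms(1) by (rule proper_not_MInf)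
  ultimately show ?thesis using that by (cases "f p") blast+
qed

text \<open>
  Lower semicontinuity bounds \<open>f\<close> from below near a point of its domain, and convexity along
  the segment to a distant point turns that local bound into one of linear decay. This is what
  keeps the infimum in the envelope finite.
\<close>

lemma convex_lsc_minorant:
  fixes f :: "'a::{real_inner,complete_space} \<Rightarrow> ereal"
  assumes "f \<in> Gamma0"
  obtains x0 c d where "c \<ge> 0" "\<And>y. ereal (d - c * norm (y - x0)) \<le> f y"
proof -
  note D = Gamma0D[OF assms]
  obtain x0 where "f x0 \<noteq> \<infinity>" using D(3) by (auto simp: proper_def)
  with proper_not_MInf[OF D(3), of x0] obtain r where r: "f x0 = ereal r"
    by (cases "f x0") auto
  have "ereal (r - 1) < f x0" by (simp add: r)
  then have "ereal (r - 1) < Liminf (nhds x0) f"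
    using D(2) by (metis lower_semicont_def less_le_trans)
  then have "\<forall>\<^sub>F y in nhds x0. ereal (r - 1) < f y"
    by (metis less_LiminfD)
  then obtain e where e: "e > 0" "\<And>y. dist y x0 < e \<Longrightarrow> ereal (r - 1) < f y"
    by (auto simp: eventually_nhds_metric)
  have "ereal (r - 1 - (2 / e) * norm (y - x0)) \<le> f y" for y
  proof (cases "dist y x0 < e")
    case True
    have "r - 1 - (2 / e) * norm (y - x0) \<le> r - 1" using e(1) by simp
    then show ?thesis using e(2)[OF True] by (meson ereal_less_eq(3) less_imp_le order_trans)
  next
    case False
    define N where "N = norm (y - x0)"
    have N: "N \<ge> e" using False by (simp add: N_def dist_norm)
    \<comment> \<open>the point at parameter \<open>t\<close> lies at distance \<open>e / 2\<close> from \<open>x0\<close>, inside the ball\<close>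
    define t where "t = e / (2 * N)"
    have t: "0 < t" "t < 1" using N e(1) by (auto simp: t_def field_simps)
    have "dist ((1 - t) *\<^sub>R x0 + t *\<^sub>R y) x0 = norm (t *\<^sub>R (y - x0))"
      by (simp add: dist_norm algebra_simps)
    also have "\<dots> = e / 2" using N e(1) t by (simp add: N_def[symmetric]) (simp add: t_def)
    finally have "ereal (r - 1) < f ((1 - t) *\<^sub>R x0 + t *\<^sub>R y)" using e by simp
    also have "\<dots> \<le> ereal (1 - t) * f x0 + ereal t * f y"
      using D(1) t by (auto simp: convex_ext_def)
    finally have *: "ereal (r - 1) < ereal (1 - t) * f x0 + ereal t * f y" .
    show ?thesis
    proof (cases "f y")
      case (real s)
      have "r - 1 < (1 - t) * r + t * s" using * by (simp add: real r)
      then have "0 < 1 + t * (s - r)" by (simp add: algebra_simps)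
      then have "0 < (1 + t * (s - r)) / t" using t by simp
      then have "0 < 1 / t + (s - r)" using t by (simp add: add_divide_distrib)
      moreover have "1 / t = 2 / e * N" by (simp add: t_def)
      ultimately show ?thesis by (simp add: real N_def)
    next
      case PInf then show ?thesis by simp
    next
      case MInf then show ?thesis using proper_not_MInf[OF D(3)] by simp
    qed
  qed
  moreover have "2 / e \<ge> 0" using e by simp
  ultimately show ?thesis using that by blast
qed

text \<open>
  Along the segment from \<open>p\<close> to \<open>y\<close> the quadratic term changes linearly up to an error of
  second order in the parameter \<open>t\<close>, so dividing the minimality inequality by \<open>t\<close> and
  letting \<open>t\<close> tend to 0 leaves the subgradient inequality.
\<close>

lemma minimizer_imp_subgradient:
  fixes f :: "'a::real_inner \<Rightarrow> ereal"
  assumes conv: "convex_ext f" and pr: "proper f" and p: "f p = ereal r"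
    and min: "\<And>y. f p + ereal ((norm (x - p))\<^sup>2 / 2) \<le> f y + ereal ((norm (x - y))\<^sup>2 / 2)"
  shows "x - p \<in> subdifferential f p"
proof -
  have expand: "t * ((s - r - b) + t * (c / 2))
      = ((1 - t) * r + t * s + (a - 2 * t * b + t\<^sup>2 * c) / 2) - (r + a / 2)"
    for t r s a b c :: real
    by (simp add: field_simps power2_eq_square)
  have "f p + ereal ((y - p) \<bullet> (x - p)) \<le> f y" for y
  proof (cases "f y")
    case (real s)
    have ineq: "0 \<le> (s - r - (y - p) \<bullet> (x - p)) + t * ((norm (y - p))\<^sup>2 / 2)"
      if t: "0 < t" "t < 1" for t
    proof -
      let ?z = "(1 - t) *\<^sub>R p + t *\<^sub>R y"
      have z: "f ?z \<le> ereal ((1 - t) * r + t * s)"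
        using conv[unfolded convex_ext_def, rule_format, of t p y] t by (simp add: real p)
      have "x - ?z = (x - p) - t *\<^sub>R (y - p)" by (simp add: algebra_simps)
      then have n: "(norm (x - ?z))\<^sup>2
          = (norm (x - p))\<^sup>2 - 2 * t * ((y - p) \<bullet> (x - p)) + t\<^sup>2 * (norm (y - p))\<^sup>2"
        by (simp only: power2_norm_eq_inner)
          (simp add: inner_diff_left inner_diff_right inner_commute power2_eq_square algebra_simps)
      have "ereal (r + (norm (x - p))\<^sup>2 / 2) \<le> f ?z + ereal ((norm (x - ?z))\<^sup>2 / 2)"
        using min[of ?z] p by simp
      also have "\<dots> \<le> ereal ((1 - t) * r + t * s) + ereal ((norm (x - ?z))\<^sup>2 / 2)"
        by (rule add_right_mono[OF z])
      finally have "r + (norm (x - p))\<^sup>2 / 2 \<le> (1 - t) * r + t * s + (norm (x - ?z))\<^sup>2 / 2"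
        by simp
      then have "0 \<le> t * ((s - r - (y - p) \<bullet> (x - p)) + t * ((norm (y - p))\<^sup>2 / 2))"
        unfolding n expand[where a = "(norm (x - p))\<^sup>2"] by simp
      then show ?thesis using t by (simp add: zero_le_mult_iff)
    qed
    have "((\<lambda>t. (s - r - (y - p) \<bullet> (x - p)) + t * ((norm (y - p))\<^sup>2 / 2)) \<longlongrightarrow>
       (s - r - (y - p) \<bullet> (x - p)) + 0 * ((norm (y - p))\<^sup>2 / 2)) (at_right (0::real))"
      by (intro tendsto_intros)
    moreover have "\<forall>\<^sub>F t in at_right (0::real).
        0 \<le> (s - r - (y - p) \<bullet> (x - p)) + t * ((norm (y - p))\<^sup>2 / 2)"
      unfolding eventually_at_right_field using ineq by (intro exI[of _ 1]) auto
    ultimately have "0 \<le> (s - r - (y - p) \<bullet> (x - p)) + 0 * ((norm (y - p))\<^sup>2 / 2)"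
      by (rule tendsto_lowerbound) simp
    then show ?thesis by (simp add: p real)
  next
    case PInf then show ?thesis by simp
  next
    case MInf then show ?thesis using proper_not_MInf[OF pr] by simp
  qed
  then show ?thesis by (simp add: subdifferential_def)
qed

lemma env_real:
  fixes f :: "'a::{real_inner,complete_space} \<Rightarrow> ereal"
  assumes "f \<in> Gamma0"
  obtains m where "env f x = ereal m"
proof -
  note D = Gamma0D[OF assms]
  obtain x0 c d where c: "c \<ge> 0" and lb: "\<And>y. ereal (d - c * norm (y - x0)) \<le> f y"
    by (rule convex_lsc_minorant[OF assms]) (rule that)
  have "ereal (d - c * norm (x - x0) - c\<^sup>2 / 2) \<le> f y + ereal ((norm (x - y))\<^sup>2 / 2)" for y
  proof -
    have "norm (y - x0) \<le> norm (x - x0) + norm (x - y)"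
      using norm_triangle_ineq[of "x - x0" "y - x"] norm_minus_commute[of x y] by simp
    from mult_left_mono[OF this c]
    have "c * norm (y - x0) \<le> c * norm (x - x0) + c * norm (x - y)"
      by (simp only: distrib_left)
    \<comment> \<open>the quadratic penalty absorbs the linear decay of the minorant\<close>
    moreover have "0 \<le> c\<^sup>2 + (norm (x - y))\<^sup>2 - 2 * c * norm (x - y)"
      unfolding power2_diff[symmetric] by (rule zero_le_power2)
    ultimately have "d - c * norm (x - x0) - c\<^sup>2 / 2
        \<le> (d - c * norm (y - x0)) + (norm (x - y))\<^sup>2 / 2"
      by linarith
    then have "ereal (d - c * norm (x - x0) - c\<^sup>2 / 2)
        \<le> ereal (d - c * norm (y - x0)) + ereal ((norm (x - y))\<^sup>2 / 2)" by simp
    also have "\<dots> \<le> f y + ereal ((norm (x - y))\<^sup>2 / 2)" by (rule add_right_mono[OF lb])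
    finally show ?thesis .
  qed
  then have "ereal (d - c * norm (x - x0) - c\<^sup>2 / 2) \<le> env f x"
    unfolding env_def by (rule INF_greatest)
  moreover have "env f x \<noteq> \<infinity>"
  proof
    assume inf: "env f x = \<infinity>"
    obtain y where y: "f y \<noteq> \<infinity>" using D(3) by (auto simp: proper_def)
    have "env f x \<le> f y + ereal ((norm (x - y))\<^sup>2 / 2)"
      unfolding env_def by (rule INF_lower) simp
    then show False using y inf by simp
  qed
  ultimately show ?thesis using that by (cases "env f x") auto
qed

text \<open>
  The surjectivity half of Minty's theorem for subdifferentials, by the direct method: the
  function \<open>y \<mapsto> f y + \<parallel>x - y\<parallel>\<^sup>2 / 2\<close> is strongly convex, so its minimizing sequences are
  Cauchy, and lower semicontinuity makes their limit a minimizer.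
\<close>

lemma prox_exists:
  fixes f :: "'a::{real_inner,complete_space} \<Rightarrow> ereal"
  assumes "f \<in> Gamma0"
  obtains p where "x - p \<in> subdifferential f p"
proof -
  note D = Gamma0D[OF assms]
  obtain m where m: "env f x = ereal m" using env_real[OF assms] by blast
  have mle: "ereal m \<le> f y + ereal ((norm (x - y))\<^sup>2 / 2)" for y
    unfolding m[symmetric] env_def by (rule INF_lower) simp
  have "\<exists>y s. f y = ereal s \<and> s + (norm (x - y))\<^sup>2 / 2 < m + 1 / real (Suc n)" for n
  proof -
    have "env f x < ereal (m + 1 / real (Suc n))" by (simp add: m)
    then obtain y where y: "f y + ereal ((norm (x - y))\<^sup>2 / 2) < ereal (m + 1 / real (Suc n))"
      unfolding env_def INF_less_iff by blast
    then show ?thesis using proper_not_MInf[OF D(3), of y] by (cases "f y") auto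
  qed
  then obtain Y s where Y: "\<And>n. f (Y n) = ereal (s n)"
      "\<And>n. s n + (norm (x - Y n))\<^sup>2 / 2 < m + 1 / real (Suc n)"
    by metis
  \<comment> \<open>the parallelogram law: if two near-minimizers were far apart, their midpoint would beat the infimum\<close>
  have close: "(norm (Y i - Y j))\<^sup>2 \<le> 4 * (1 / real (Suc i) + 1 / real (Suc j))" for i j
  proof -
    let ?z = "(1 - 1/2) *\<^sub>R Y i + (1/2::real) *\<^sub>R Y j"
    have "f ?z \<le> ereal (1 - 1/2) * f (Y i) + ereal (1/2) * f (Y j)"
      using D(1)[unfolded convex_ext_def, rule_format, of "1/2" "Y i" "Y j"] by simp
    then have z: "f ?z \<le> ereal (s i / 2 + s j / 2)" by (simp add: Y(1))
    have "ereal m \<le> f ?z + ereal ((norm (x - ?z))\<^sup>2 / 2)" by (rule mle)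
    also have "\<dots> \<le> ereal (s i / 2 + s j / 2) + ereal ((norm (x - ?z))\<^sup>2 / 2)"
      by (rule add_right_mono[OF z])
    finally have le: "m \<le> s i / 2 + s j / 2 + (norm (x - ?z))\<^sup>2 / 2" by simp
    define a b where "a = x - Y i" and "b = x - Y j"
    have xz: "x - ?z = (1/2) *\<^sub>R (a + b)"
      by (simp add: a_def b_def algebra_simps flip: scaleR_left_distrib)
    have yy: "Y i - Y j = b - a" by (simp add: a_def b_def)
    have par: "4 * (norm (x - ?z))\<^sup>2 = 2 * (norm a)\<^sup>2 + 2 * (norm b)\<^sup>2 - (norm (Y i - Y j))\<^sup>2"
      unfolding xz yy power2_norm_eq_inner
      by (simp add: inner_add_left inner_add_right inner_diff_left inner_diff_right inner_commute)
    show ?thesis using le par Y(2)[of i] Y(2)[of j] by (simp add: a_def b_def)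
  qed
  have "Cauchy Y"
  proof (rule metric_CauchyI)
    fix e :: real assume e: "e > 0"
    obtain N where N: "1 / real (Suc N) < e\<^sup>2 / 8"
      using e nat_approx_posE[of "e\<^sup>2 / 8"] by auto
    have "dist (Y i) (Y j) < e" if "i \<ge> N" "j \<ge> N" for i j
    proof -
      define \<delta> where "\<delta> n = 1 / real (Suc n)" for n
      have "\<delta> i \<le> \<delta> N" "\<delta> j \<le> \<delta> N"
        using that by (auto simp: \<delta>_def intro!: divide_left_mono)
      then have "4 * (\<delta> i + \<delta> j) < e\<^sup>2" using N[folded \<delta>_def] by simp
      then have "(norm (Y i - Y j))\<^sup>2 < e\<^sup>2"
        using close[of i j, folded \<delta>_def] by linarith
      then show ?thesis using e by (simp add: dist_norm power2_less_imp_less)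
    qed
    then show "\<exists>M. \<forall>m\<ge>M. \<forall>n\<ge>M. dist (Y m) (Y n) < e" by blast
  qed
  then obtain p where p: "Y \<longlonglongrightarrow> p" using Cauchy_convergent convergent_def by blast
  have fp: "f p \<le> ereal (m - (norm (x - p))\<^sup>2 / 2)"
  proof (rule ccontr)
    assume "\<not> ?thesis"
    then obtain C where C: "ereal (m - (norm (x - p))\<^sup>2 / 2) < ereal C" "ereal C < f p"
      using ereal_dense2 by (metis not_le)
    then have "ereal C < Liminf (nhds p) f"
      using D(2) by (metis lower_semicont_def less_le_trans)
    then have "\<forall>\<^sub>F y in nhds p. ereal C < f y" by (metis less_LiminfD)
    then have "\<forall>\<^sub>F n in sequentially. ereal C < f (Y n)"
      using p by (auto simp: filterlim_iff)
    then have "\<forall>\<^sub>F n in sequentially. C \<le> m + 1 / real (Suc n) - (norm (x - Y n))\<^sup>2 / 2"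
    proof eventually_elim
      case (elim n) then show ?case using Y(1)[of n] Y(2)[of n] by simp
    qed
    moreover have "(\<lambda>n. m + 1 / real (Suc n) - (norm (x - Y n))\<^sup>2 / 2)
        \<longlonglongrightarrow> m + 0 - (norm (x - p))\<^sup>2 / 2"
      by (intro tendsto_intros p LIMSEQ_Suc[OF lim_1_over_n]) simp
    ultimately have "C \<le> m + 0 - (norm (x - p))\<^sup>2 / 2"
      by (intro tendsto_lowerbound[OF _ _ sequentially_bot])
    then show False using C(1) by simp
  qed
  then obtain r where r: "f p = ereal r" using proper_not_MInf[OF D(3), of p] by (cases "f p") auto
  have "f p + ereal ((norm (x - p))\<^sup>2 / 2) \<le> f y + ereal ((norm (x - y))\<^sup>2 / 2)" for y
  proof -
    have "f p + ereal ((norm (x - p))\<^sup>2 / 2) \<le> ereal m" using fp by (simp add: r)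
    then show ?thesis using mle[of y] by (rule order_trans)
  qed
  from minimizer_imp_subgradient[OF D(1) D(3) r this] show ?thesis by (rule that)
qed

lemma subdifferential_monotone:
  assumes pr: "proper f" and u: "u \<in> subdifferential f p" and v: "v \<in> subdifferential f q"
  shows "0 \<le> (p - q) \<bullet> (u - v)"
proof -
  obtain r where r: "f p = ereal r" using subdifferential_imp_finite[OF pr u] by blast
  obtain s where s: "f q = ereal s" using subdifferential_imp_finite[OF pr v] by blast
  have "r + (q - p) \<bullet> u \<le> s" using subdifferentialD[OF u, of q] by (simp add: r s)
  moreover have "s + (p - q) \<bullet> v \<le> r" using subdifferentialD[OF v, of p] by (simp add: r s)
  ultimately show ?thesis by (simp add: inner_diff_left inner_diff_right)
qed

lemma prox_eqI:
  fixes f :: "'a::real_inner \<Rightarrow> ereal"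
  assumes pr: "proper f" and p: "x - p \<in> subdifferential f p"
  shows "prox f x = p"
  unfolding prox_def
proof (rule the_equality)
  show "x \<in> (+) p ` subdifferential f p" using p by (force intro: image_eqI[of _ _ "x - p"])
next
  fix q assume "x \<in> (+) q ` subdifferential f q"
  then have "x - q \<in> subdifferential f q" by auto
  then have "0 \<le> (q - p) \<bullet> ((x - q) - (x - p))"
    using subdifferential_monotone[OF pr] p by blast
  also have "\<dots> = - ((q - p) \<bullet> (q - p))" by (simp add: inner_diff_right)
  finally have "(q - p) \<bullet> (q - p) = 0"
    using inner_ge_zero[of "q - p"] by linarith
  then show "q = p" by simp
qed

lemma prox_subgradient:
  fixes f :: "'a::{real_inner,complete_space} \<Rightarrow> ereal"
  assumes "f \<in> Gamma0"
  shows "x - prox f x \<in> subdifferential f (prox f x)"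
proof -
  obtain p where p: "x - p \<in> subdifferential f p" using prox_exists[OF assms] by blast
  have "prox f x = p" by (rule prox_eqI[OF Gamma0D(3)[OF assms] p])
  then show ?thesis using p by simp
qed

text \<open>
  The subgradient inequality at \<open>p\<close>, with \<open>\<parallel>x - y\<parallel>\<^sup>2\<close> expanded around \<open>x - p\<close>, says that
  \<open>p\<close> attains the infimum that defines the envelope at \<open>x\<close>.
\<close>

lemma env_eq_subgradient:
  fixes f :: "'a::real_inner \<Rightarrow> ereal"
  assumes p: "x - p \<in> subdifferential f p"
  shows "env f x = f p + ereal ((norm (x - p))\<^sup>2 / 2)"
proof (rule antisym)
  show "env f x \<le> f p + ereal ((norm (x - p))\<^sup>2 / 2)"
    unfolding env_def by (rule INF_lower) simp
  have "f p + ereal ((norm (x - p))\<^sup>2 / 2) \<le> f y + ereal ((norm (x - y))\<^sup>2 / 2)" for y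
  proof -
    have "(norm (x - y))\<^sup>2
        = (norm (x - p))\<^sup>2 - 2 * ((y - p) \<bullet> (x - p)) + (norm (y - p))\<^sup>2"
      unfolding power2_norm_eq_inner
      by (simp add: inner_diff_left inner_diff_right inner_commute algebra_simps)
    moreover have "0 \<le> (norm (y - p))\<^sup>2" by simp
    ultimately have "(norm (x - p))\<^sup>2 / 2 \<le> (y - p) \<bullet> (x - p) + (norm (x - y))\<^sup>2 / 2"
      by linarith
    then have "f p + ereal ((norm (x - p))\<^sup>2 / 2)
        \<le> f p + (ereal ((y - p) \<bullet> (x - p)) + ereal ((norm (x - y))\<^sup>2 / 2))"
      by (intro add_left_mono) simp
    also have "\<dots> = (f p + ereal ((y - p) \<bullet> (x - p))) + ereal ((norm (x - y))\<^sup>2 / 2)"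
      by (simp only: add.assoc)
    also have "\<dots> \<le> f y + ereal ((norm (x - y))\<^sup>2 / 2)"
      by (rule add_right_mono[OF subdifferentialD[OF p]])
    finally show ?thesis .
  qed
  then show "f p + ereal ((norm (x - p))\<^sup>2 / 2) \<le> env f x"
    unfolding env_def by (rule INF_greatest)
qed

section \<open>Conjugates and the Moreau decomposition\<close>

text \<open>
  The source of members of \<^const>\<open>Gamma0\<close>: it provides both Fenchel conjugates and the function
  whose envelope is to be recovered from a gradient. Convexity and lower semicontinuity pass to
  suprema, and any single member of the family keeps the supremum above \<open>-\<infinity>\<close>.
\<close>

lemma SUP_affine_in_Gamma0:
  fixes a :: "'i \<Rightarrow> 'a::{real_inner,complete_space}" and c :: "'i \<Rightarrow> real"
  assumes ne: "I \<noteq> {}" and fin: "(SUP i\<in>I. ereal (c i + y0 \<bullet> a i)) \<noteq> \<infinity>"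
  shows "(\<lambda>y. SUP i\<in>I. ereal (c i + y \<bullet> a i)) \<in> Gamma0"
proof -
  define S where "S y = (SUP i\<in>I. ereal (c i + y \<bullet> a i))" for y
  have up: "ereal (c i + y \<bullet> a i) \<le> S y" if "i \<in> I" for i y
    unfolding S_def by (rule SUP_upper[OF that])
  have "S ((1 - t) *\<^sub>R x + t *\<^sub>R y) \<le> ereal (1 - t) * S x + ereal t * S y"
    if t: "0 < t" "t < 1" for x y t
    unfolding S_def[of "(1 - t) *\<^sub>R x + t *\<^sub>R y"]
  proof (rule SUP_least)
    fix i assume i: "i \<in> I"
    have "c i + ((1 - t) *\<^sub>R x + t *\<^sub>R y) \<bullet> a i
        = (1 - t) * (c i + x \<bullet> a i) + t * (c i + y \<bullet> a i)"
      by (simp add: inner_add_left algebra_simps)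
    then have "ereal (c i + ((1 - t) *\<^sub>R x + t *\<^sub>R y) \<bullet> a i)
        = ereal (1 - t) * ereal (c i + x \<bullet> a i) + ereal t * ereal (c i + y \<bullet> a i)" by simp
    also have "\<dots> \<le> ereal (1 - t) * S x + ereal t * S y"
      using t by (intro add_mono ereal_mult_left_mono up i) auto
    finally show "ereal (c i + ((1 - t) *\<^sub>R x + t *\<^sub>R y) \<bullet> a i)
        \<le> ereal (1 - t) * S x + ereal t * S y" .
  qed
  then have "convex_ext S" by (simp add: convex_ext_def)
  moreover have "S y \<le> Liminf (nhds y) S" for y
    unfolding le_Liminf_iff
  proof (intro allI impI)
    fix C assume "C < S y"
    then obtain i where i: "i \<in> I" "C < ereal (c i + y \<bullet> a i)"
      unfolding S_def less_SUP_iff by blast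
    have "((\<lambda>z. ereal (c i + z \<bullet> a i)) \<longlongrightarrow> ereal (c i + y \<bullet> a i)) (nhds y)"
      by (intro tendsto_intros filterlim_ident)
    then have "\<forall>\<^sub>F z in nhds y. C < ereal (c i + z \<bullet> a i)"
      using i(2) by (rule order_tendstoD(1))
    then show "\<forall>\<^sub>F z in nhds y. C < S z"
      by eventually_elim (rule less_le_trans[OF _ up[OF i(1)]])
  qed
  then have "lower_semicont S" by (simp add: lower_semicont_def)
  moreover have "proper S"
  proof -
    obtain i where "i \<in> I" using ne by blast
    then have "S y \<noteq> -\<infinity>" for y using up[of i y] by auto
    moreover have "S y0 \<noteq> \<infinity>" using fin by (simp add: S_def)
    ultimately show ?thesis by (auto simp: proper_def)
  qed
  ultimately have "S \<in> Gamma0" by (simp add: Gamma0_def)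
  then show ?thesis by (simp add: S_def[abs_def])
qed

text \<open>
  The case of equality in the Fenchel-Young inequality: a subgradient at \<open>p\<close> makes \<open>p\<close> a
  maximizer of the expression that defines the conjugate.
\<close>

lemma fenchel_conj_subgradient:
  fixes f :: "'a::real_inner \<Rightarrow> ereal"
  assumes u: "u \<in> subdifferential f p" and r: "f p = ereal r"
  shows "fenchel_conj f u = ereal (p \<bullet> u - r)"
proof (rule antisym)
  have "ereal (x \<bullet> u) - f x \<le> ereal (p \<bullet> u - r)" for x
    using subdifferentialD[OF u, of x]
    by (cases "f x") (auto simp: r inner_diff_left)
  then show "fenchel_conj f u \<le> ereal (p \<bullet> u - r)"
    unfolding fenchel_conj_def by (rule SUP_least)
  have "ereal (p \<bullet> u) - f p \<le> fenchel_conj f u"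
    unfolding fenchel_conj_def by (rule SUP_upper) simp
  then show "ereal (p \<bullet> u - r) \<le> fenchel_conj f u" by (simp add: r)
qed

lemma fenchel_conj_in_Gamma0:
  fixes f :: "'a::{real_inner,complete_space} \<Rightarrow> ereal"
  assumes "f \<in> Gamma0"
  shows "fenchel_conj f \<in> Gamma0"
proof -
  note pr = Gamma0D(3)[OF assms]
  \<comment> \<open>points outside the domain contribute \<open>-\<infinity>\<close>, so the conjugate is a supremum of affine functions\<close>
  define I where "I = {x. f x \<noteq> \<infinity>}"
  have fin: "ereal (real_of_ereal (f x)) = f x" if "x \<in> I" for x
    using that proper_not_MInf[OF pr, of x] by (cases "f x") (auto simp: I_def)
  have eq: "fenchel_conj f u = (SUP x\<in>I. ereal (- real_of_ereal (f x) + u \<bullet> x))" for u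
  proof (rule antisym)
    show "fenchel_conj f u \<le> (SUP x\<in>I. ereal (- real_of_ereal (f x) + u \<bullet> x))"
      unfolding fenchel_conj_def
    proof (rule SUP_least)
      fix x
      show "ereal (x \<bullet> u) - f x \<le> (SUP x\<in>I. ereal (- real_of_ereal (f x) + u \<bullet> x))"
      proof (cases "x \<in> I")
        case True
        have "ereal (x \<bullet> u) - f x = ereal (- real_of_ereal (f x) + u \<bullet> x)"
          by (subst fin[OF True, symmetric]) (simp add: inner_commute)
        also have "\<dots> \<le> (SUP x\<in>I. ereal (- real_of_ereal (f x) + u \<bullet> x))"
          by (rule SUP_upper[OF True])
        finally show ?thesis .
      next
        case False then show ?thesis by (simp add: I_def)
      qed
    qed
    show "(SUP x\<in>I. ereal (- real_of_ereal (f x) + u \<bullet> x)) \<le> fenchel_conj f u"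
    proof (rule SUP_least)
      fix x assume x: "x \<in> I"
      have "ereal (- real_of_ereal (f x) + u \<bullet> x) = ereal (x \<bullet> u) - f x"
        by (subst fin[OF x, symmetric]) (simp add: inner_commute)
      also have "\<dots> \<le> fenchel_conj f u"
        unfolding fenchel_conj_def by (rule SUP_upper) simp
      finally show "ereal (- real_of_ereal (f x) + u \<bullet> x) \<le> fenchel_conj f u" .
    qed
  qed
  have "I \<noteq> {}" using pr by (auto simp: I_def proper_def)
  moreover obtain u where "fenchel_conj f u \<noteq> \<infinity>"
  proof -
    have u: "0 - prox f 0 \<in> subdifferential f (prox f 0)" by (rule prox_subgradient[OF assms])
    obtain r where "f (prox f 0) = ereal r" using subdifferential_imp_finite[OF pr u] by blast
    from that fenchel_conj_subgradient[OF u this] show thesis by (metis PInfty_neq_ereal(1))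
  qed
  ultimately have "(\<lambda>u. SUP x\<in>I. ereal (- real_of_ereal (f x) + u \<bullet> x)) \<in> Gamma0"
    unfolding eq by (rule SUP_affine_in_Gamma0)
  then show ?thesis by (simp add: eq[abs_def])
qed

text \<open>
  The conjugate is a supremum of affine functions in \<open>v\<close>, and the one with slope \<open>p\<close> attains
  it at \<open>u\<close>. Exchanging point and subgradient in this way is what turns the proximal point
  \<open>prox f x\<close> of \<open>f\<close> into the proximal point \<open>x - prox f x\<close> of its conjugate.
\<close>

lemma subgradient_fenchel_conj:
  fixes f :: "'a::real_inner \<Rightarrow> ereal"
  assumes u: "u \<in> subdifferential f p" and r: "f p = ereal r"
  shows "p \<in> subdifferential (fenchel_conj f) u"
proof -
  have "fenchel_conj f u + ereal ((v - u) \<bullet> p) \<le> fenchel_conj f v" for v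
  proof -
    have "fenchel_conj f u + ereal ((v - u) \<bullet> p) = ereal (p \<bullet> v) - f p"
      by (simp add: fenchel_conj_subgradient[OF u r] r inner_diff_left inner_commute[of p])
    also have "\<dots> \<le> fenchel_conj f v"
      unfolding fenchel_conj_def by (rule SUP_upper) simp
    finally show ?thesis .
  qed
  then show ?thesis by (simp add: subdifferential_def)
qed

lemma prox_fenchel_conj:
  fixes f :: "'a::{real_inner,complete_space} \<Rightarrow> ereal"
  assumes "f \<in> Gamma0"
  shows "prox (fenchel_conj f) x = x - prox f x"
proof (rule prox_eqI)
  show "proper (fenchel_conj f)" using fenchel_conj_in_Gamma0[OF assms] by (rule Gamma0D(3))
  have u: "x - prox f x \<in> subdifferential f (prox f x)" by (rule prox_subgradient[OF assms])
  obtain r where "f (prox f x) = ereal r"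
    using subdifferential_imp_finite[OF Gamma0D(3)[OF assms] u] by blast
  from subgradient_fenchel_conj[OF u this]
  show "x - (x - prox f x) \<in> subdifferential (fenchel_conj f) (x - prox f x)" by simp
qed

lemma ereal_real_of_env:
  fixes f :: "'a::{real_inner,complete_space} \<Rightarrow> ereal"
  assumes "f \<in> Gamma0"
  shows "ereal (real_of_ereal (env f x)) = env f x"
proof -
  obtain m where "env f x = ereal m" using env_real[OF assms] by blast
  then show ?thesis by simp
qed

text \<open>
  Both envelopes are attained, at \<open>p = prox f x\<close> and at \<open>x - p\<close>. Equality in Fenchel-Young
  evaluates the conjugate at \<open>x - p\<close>, and adding the two values completes the square.
\<close>

lemma env_fenchel_conj:
  fixes f :: "'a::{real_inner,complete_space} \<Rightarrow> ereal"
  assumes "f \<in> Gamma0"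
  shows "env (fenchel_conj f) x = ereal ((norm x)\<^sup>2 / 2) - env f x"
proof -
  define p where "p = prox f x"
  have u: "x - p \<in> subdifferential f p" unfolding p_def by (rule prox_subgradient[OF assms])
  obtain r where r: "f p = ereal r"
    using subdifferential_imp_finite[OF Gamma0D(3)[OF assms] u] by blast
  have "x - (x - p) \<in> subdifferential (fenchel_conj f) (x - p)"
    using subgradient_fenchel_conj[OF u r] by simp
  then have "env (fenchel_conj f) x = ereal (p \<bullet> (x - p) - r + (norm p)\<^sup>2 / 2)"
    using env_eq_subgradient[of x "x - p" "fenchel_conj f"] fenchel_conj_subgradient[OF u r] by simp
  moreover have "env f x = ereal (r + (norm (x - p))\<^sup>2 / 2)"
    using env_eq_subgradient[OF u] r by simp
  moreover have "(norm x)\<^sup>2 = (norm (x - p))\<^sup>2 + 2 * (p \<bullet> (x - p)) + (norm p)\<^sup>2"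
    unfolding power2_norm_eq_inner
    by (simp add: inner_diff_left inner_diff_right inner_commute algebra_simps)
  ultimately show ?thesis by (simp add: add_divide_distrib)
qed

section \<open>The gradient of the envelope\<close>

text \<open>
  The subgradient inequality for \<open>f\<close> between the two proximal points, rewritten in terms of
  the envelope. The quadratic remainder matters: it supplies the matching upper bound
  when the roles of \<open>x\<close> and \<open>y\<close> are exchanged, and thus differentiability.
\<close>

lemma env_lower_bound:
  fixes f :: "'a::{real_inner,complete_space} \<Rightarrow> ereal"
  assumes "f \<in> Gamma0"
  shows "real_of_ereal (env f y) \<ge> real_of_ereal (env f x) + (y - x) \<bullet> (x - prox f x)
           + (norm ((y - prox f y) - (x - prox f x)))\<^sup>2 / 2"
proof -
  define p q u v where "p = prox f x" and "q = prox f y" and "u = x - p" and "v = y - q"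
  note pr = Gamma0D(3)[OF assms]
  have u: "x - p \<in> subdifferential f p" unfolding p_def by (rule prox_subgradient[OF assms])
  have v: "y - q \<in> subdifferential f q" unfolding q_def by (rule prox_subgradient[OF assms])
  obtain r where r: "f p = ereal r" using subdifferential_imp_finite[OF pr u] by blast
  obtain s where s: "f q = ereal s" using subdifferential_imp_finite[OF pr v] by blast
  have "env f x = ereal (r + (norm u)\<^sup>2 / 2)"
    using env_eq_subgradient[OF u] by (simp add: r u_def)
  moreover have "env f y = ereal (s + (norm v)\<^sup>2 / 2)"
    using env_eq_subgradient[OF v] by (simp add: s v_def)
  moreover have "r + (q - p) \<bullet> u \<le> s"
    using subdifferentialD[OF u, of q] by (simp add: r s u_def)
  moreover have "q - p = (y - x) - (v - u)" by (simp add: u_def v_def)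
  moreover have "(norm (v - u))\<^sup>2 = (norm v)\<^sup>2 - 2 * (v \<bullet> u) + (norm u)\<^sup>2"
    "u \<bullet> u = (norm u)\<^sup>2"
    unfolding power2_norm_eq_inner
    by (simp_all add: inner_diff_left inner_diff_right inner_commute)
  ultimately show ?thesis
    unfolding p_def[symmetric] q_def[symmetric] u_def[symmetric] v_def[symmetric]
    by (simp add: inner_diff_left add_divide_distrib diff_divide_distrib)
qed

text \<open>
  The two-sided bound of \<open>env_lower_bound\<close> pins the first-order remainder between 0 and
  \<open>\<parallel>y - x\<parallel>\<^sup>2 / 2\<close>.
\<close>

lemma env_GDERIV:
  fixes f :: "'a::{real_inner,complete_space} \<Rightarrow> ereal"
  assumes "f \<in> Gamma0"
  shows "GDERIV (\<lambda>x. real_of_ereal (env f x)) x :> x - prox f x"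
proof -
  define E where "E x = real_of_ereal (env f x)" for x
  define u where "u x = x - prox f x" for x
  have lb: "E y \<ge> E x + (y - x) \<bullet> u x + (norm (u y - u x))\<^sup>2 / 2" for x y
    unfolding E_def u_def by (rule env_lower_bound[OF assms])
  have rem: "\<bar>E y - E x - (y - x) \<bullet> u x\<bar> \<le> (norm (y - x))\<^sup>2 / 2" for y
  proof -
    have "0 \<le> (norm ((y - x) - (u y - u x)))\<^sup>2" by simp
    also have "\<dots> = (norm (y - x))\<^sup>2 - 2 * ((y - x) \<bullet> (u y - u x)) + (norm (u y - u x))\<^sup>2"
      unfolding power2_norm_eq_inner
      by (simp add: inner_diff_left inner_diff_right inner_commute)
    finally have "(y - x) \<bullet> u y - (y - x) \<bullet> u x
        \<le> (norm (y - x))\<^sup>2 / 2 + (norm (u y - u x))\<^sup>2 / 2" by (simp add: inner_diff_right)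
    moreover have "E x \<ge> E y - (y - x) \<bullet> u y + (norm (u y - u x))\<^sup>2 / 2"
      using lb[of y x] by (simp add: norm_minus_commute inner_diff_left)
    moreover have "0 \<le> (norm (u y - u x))\<^sup>2 / 2" by simp
    ultimately show ?thesis using lb[of x y] by linarith
  qed
  have "((\<lambda>y. (E y - E x - (y - x) \<bullet> u x) /\<^sub>R norm (y - x)) \<longlongrightarrow> 0) (at x)"
  proof (rule Lim_null_comparison)
    show "\<forall>\<^sub>F y in at x. norm ((E y - E x - (y - x) \<bullet> u x) /\<^sub>R norm (y - x)) \<le> norm (y - x) / 2"
    proof (intro always_eventually allI)
      fix y
      show "norm ((E y - E x - (y - x) \<bullet> u x) /\<^sub>R norm (y - x)) \<le> norm (y - x) / 2"
        using rem[of y] 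
        by (cases "y = x") (auto simp: field_simps power2_eq_square abs_mult)
    qed
    have "((\<lambda>y. norm (y - x) / 2) \<longlongrightarrow> norm (x - x) / 2) (at x)"
      by (intro tendsto_intros) auto
    then show "((\<lambda>y. norm (y - x) / 2) \<longlongrightarrow> 0) (at x)" by simp
  qed
  then have "(E has_derivative (\<lambda>h. h \<bullet> u x)) (at x)"
    by (simp add: has_derivative_at_within bounded_linear_inner_left diff_diff_eq)
  then show ?thesis by (simp add: gderiv_def E_def[abs_def] u_def)
qed

lemma GDERIV_unique:
  assumes "GDERIV h x :> u" "GDERIV h x :> v"
  shows "u = v"
proof -
  have "(\<lambda>d. d \<bullet> u) = (\<lambda>d. d \<bullet> v)"
    using assms unfolding gderiv_def by (rule has_derivative_unique)
  then have "(u - v) \<bullet> u = (u - v) \<bullet> v" by metis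
  then have "(u - v) \<bullet> (u - v) = 0" by (simp add: inner_diff_right)
  then show ?thesis by simp
qed

section \<open>Firmly nonexpansive gradients\<close>

text \<open>
  By the mean value theorem on the segment, the increment of \<open>h\<close> is the gradient at an
  intermediate point applied to \<open>y - x\<close>, and monotonicity compares it with the gradient at
  \<open>x\<close>.
\<close>

lemma monotone_gradient_lower_bound:
  fixes h :: "'a::real_inner \<Rightarrow> real"
  assumes grad: "\<And>x. GDERIV h x :> S x" and mono: "\<And>x y. 0 \<le> (x - y) \<bullet> (S x - S y)"
  shows "h x + (y - x) \<bullet> S x \<le> h y"
proof -
  define \<phi> where "\<phi> t = h (x + t *\<^sub>R (y - x))" for t :: real
  have der: "(\<phi> has_derivative (\<lambda>s. (s *\<^sub>R (y - x)) \<bullet> S (x + t *\<^sub>R (y - x)))) (at t)" for t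
  proof -
    have "((\<lambda>t. x + t *\<^sub>R (y - x)) has_derivative (\<lambda>s. s *\<^sub>R (y - x))) (at t)"
      by (auto intro!: derivative_eq_intros)
    from has_derivative_compose[OF this grad[unfolded gderiv_def]] show ?thesis
      unfolding \<phi>_def .
  qed
  obtain t where t: "0 < t" "t < 1"
    and eq: "\<phi> 1 - \<phi> 0 = ((1 - 0) *\<^sub>R (y - x)) \<bullet> S (x + t *\<^sub>R (y - x))"
    using mvt_simple[of 0 1 \<phi> "\<lambda>t s. (s *\<^sub>R (y - x)) \<bullet> S (x + t *\<^sub>R (y - x))"]
      has_derivative_at_withinI[OF der] by auto
  have "0 \<le> t * ((y - x) \<bullet> (S (x + t *\<^sub>R (y - x)) - S x))"
    using mono[of "x + t *\<^sub>R (y - x)" x] by simp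
  then have "(y - x) \<bullet> S x \<le> (y - x) \<bullet> S (x + t *\<^sub>R (y - x))"
    using t by (simp add: zero_le_mult_iff inner_diff_right)
  then show ?thesis using eq by (simp add: \<phi>_def)
qed

lemma firmly_nonexpansiveD:
  "T \<in> firmly_nonexpansive \<Longrightarrow> (norm (T x - T y))\<^sup>2 \<le> (x - y) \<bullet> (T x - T y)"
  by (simp add: firmly_nonexpansive_def)

text \<open>
  The Baillon-Haddad argument. Firm nonexpansiveness makes both \<open>T\<close> and \<open>Id - T\<close> monotone,
  so \<open>h\<close> and \<open>\<parallel>\<cdot>\<parallel>\<^sup>2 / 2 - h\<close> both lie above their tangents. Going from \<open>x\<close> to \<open>z\<close>
  through \<open>w\<close>, the first fact bounds \<open>h w\<close> from below and the second bounds \<open>h w\<close> from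
  above in terms of \<open>h z\<close>.
\<close>

lemma firmly_nonexpansive_gradient_lower_bound:
  fixes h :: "'a::real_inner \<Rightarrow> real"
  assumes grad: "\<And>x. GDERIV h x :> T x" and T: "T \<in> firmly_nonexpansive"
  shows "h x + (z - x) \<bullet> T x + (norm (T z - T x))\<^sup>2 / 2 \<le> h z"
proof -
  define e where "e = T z - T x"
  \<comment> \<open>the gradient step from \<open>z\<close> for \<open>h\<close> minus its linear part at \<open>x\<close>, which optimizes the bound\<close>
  define w where "w = z - e"
  have "0 \<le> (x - y) \<bullet> (T x - T y)" for x y
    using firmly_nonexpansiveD[OF T, of x y] by (meson order_trans zero_le_power2)
  from monotone_gradient_lower_bound[OF grad this]
  have lower: "h x + (w - x) \<bullet> T x \<le> h w" .
  have qgrad: "GDERIV (\<lambda>y. (y \<bullet> y) / 2 - h y) y :> y - T y" for y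
    by (rule GDERIV_diff[OF _ grad]) (auto simp: gderiv_def inner_commute intro!: derivative_eq_intros)
  have "0 \<le> (x - y) \<bullet> ((x - T x) - (y - T y))" for x y
  proof -
    have "0 \<le> (norm ((x - y) - (T x - T y)))\<^sup>2" by simp
    also have "\<dots> = (x - y) \<bullet> ((x - T x) - (y - T y))
        + ((norm (T x - T y))\<^sup>2 - (x - y) \<bullet> (T x - T y))"
      unfolding power2_norm_eq_inner
      by (simp add: inner_diff_left inner_diff_right inner_commute)
    finally show ?thesis using firmly_nonexpansiveD[OF T, of x y] by linarith
  qed
  from monotone_gradient_lower_bound[OF qgrad this, of z w]
  have "(z \<bullet> z) / 2 - h z + (w - z) \<bullet> (z - T z) \<le> (w \<bullet> w) / 2 - h w" .
  moreover have "w \<bullet> w = z \<bullet> z - 2 * (e \<bullet> z) + e \<bullet> e" "w - z = - e" "w - x = (z - x) - e"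
    by (simp_all add: w_def inner_diff_left inner_diff_right inner_commute)
  moreover have "e \<bullet> T z = e \<bullet> e + e \<bullet> T x" by (simp add: e_def flip: inner_add_right)
  ultimately have "h x + (z - x) \<bullet> T x + (e \<bullet> e) / 2 \<le> h z"
    using lower by (simp add: inner_diff_left inner_diff_right add_divide_distrib diff_divide_distrib)
  then show ?thesis by (simp add: e_def power2_norm_eq_inner)
qed

text \<open>
  The candidate \<open>k\<close> is the least function that has \<open>T x\<close> as a subgradient at \<open>x - T x\<close>
  with the value \<open>h x - \<parallel>T x\<parallel>\<^sup>2 / 2\<close> there, for every \<open>x\<close>. These
  prescriptions are consistent by \<open>firmly_nonexpansive_gradient_lower_bound\<close>.
  The proximal map and the envelope of \<open>k\<close> can then be read off, because \<open>x - T x\<close> is exhibited as the proximal point of \<open>x\<close>.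
\<close>

lemma firmly_nonexpansive_gradient_is_env:
  fixes h :: "'a::{real_inner,complete_space} \<Rightarrow> real"
  assumes grad: "\<And>x. GDERIV h x :> T x" and T: "T \<in> firmly_nonexpansive"
  obtains k where "k \<in> Gamma0" "\<And>x. env k x = ereal (h x)" "\<And>x. prox k x = x - T x"
proof -
  \<comment> \<open>constant term of the affine function with slope \<open>T x\<close> and the prescribed value at \<open>x - T x\<close>\<close>
  define c where "c x = h x - (norm (T x))\<^sup>2 / 2 - (x - T x) \<bullet> T x" for x
  define k where "k y = (SUP x. ereal (c x + y \<bullet> T x))" for y
  have up: "ereal (c x + y \<bullet> T x) \<le> k y" for x y
    unfolding k_def by (rule SUP_upper) simp
  have k: "k (z - T z) = ereal (h z - (norm (T z))\<^sup>2 / 2)" for z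
  proof (rule antisym)
    have "c x + (z - T z) \<bullet> T x \<le> h z - (norm (T z))\<^sup>2 / 2" for x
    proof -
      have "(norm (T z - T x))\<^sup>2 = (norm (T z))\<^sup>2 - 2 * (T z \<bullet> T x) + (norm (T x))\<^sup>2"
        "T x \<bullet> T x = (norm (T x))\<^sup>2"
        unfolding power2_norm_eq_inner
        by (simp_all add: inner_diff_left inner_diff_right inner_commute)
      then show ?thesis
        using firmly_nonexpansive_gradient_lower_bound[OF grad T, of x z]
        by (simp add: c_def inner_diff_left add_divide_distrib diff_divide_distrib)
    qed
    then show "k (z - T z) \<le> ereal (h z - (norm (T z))\<^sup>2 / 2)"
      unfolding k_def by (intro SUP_least) simp
    show "ereal (h z - (norm (T z))\<^sup>2 / 2) \<le> k (z - T z)"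
      using up[of z "z - T z"] by (simp add: c_def)
  qed
  have G: "k \<in> Gamma0"
    using SUP_affine_in_Gamma0[of UNIV c "0 - T 0" T] k[of 0]
    by (simp add: k_def[abs_def])
  have sub: "z - (z - T z) \<in> subdifferential k (z - T z)" for z
    unfolding subdifferential_def k
    using up[of z] by (simp add: c_def inner_diff_left algebra_simps)
  have "prox k z = z - T z" for z
    by (rule prox_eqI[OF Gamma0D(3)[OF G] sub])
  moreover have "env k z = ereal (h z)" for z
    by (simp add: env_eq_subgradient[OF sub] k)
  ultimately show ?thesis using that G by blast
qed

lemma prox_firmly_nonexpansive:
  fixes f :: "'a::{real_inner,complete_space} \<Rightarrow> ereal"
  assumes "f \<in> Gamma0"
  shows "prox f \<in> firmly_nonexpansive"
proof -
  have "(norm (prox f x - prox f y))\<^sup>2 \<le> (x - y) \<bullet> (prox f x - prox f y)" for x y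
    using subdifferential_monotone[OF Gamma0D(3)[OF assms]
        prox_subgradient[OF assms, of x] prox_subgradient[OF assms, of y]]
    unfolding power2_norm_eq_inner
    by (simp add: inner_diff_left inner_diff_right inner_commute)
  then show ?thesis by (simp add: firmly_nonexpansive_def)
qed

section \<open>Characterizations of the resolvent order\<close>

theorem theorem3p5:
  fixes f g :: "'a::{real_inner,complete_space} \<Rightarrow> ereal"
  assumes "f \<in> Gamma0" and "g \<in> Gamma0"
  shows "(prox f \<preceq>\<^sub>R prox g \<longleftrightarrow> (\<lambda>x. prox g x - prox f x) \<in> prox_maps)
    \<and> (prox f \<preceq>\<^sub>R prox g
         \<longleftrightarrow> (\<lambda>x. env (fenchel_conj g) x - env (fenchel_conj f) x) \<in> M0)
    \<and> (prox f \<preceq>\<^sub>R prox g \<longleftrightarrow> (\<lambda>x. env f x - env g x) \<in> M0)"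
proof -
  have conj_diff: "(\<lambda>x. env (fenchel_conj g) x - env (fenchel_conj f) x) = (\<lambda>x. env f x - env g x)"
  proof
    fix x
    obtain a where a: "env f x = ereal a" using env_real[OF assms(1)] by blast
    obtain b where b: "env g x = ereal b" using env_real[OF assms(2)] by blast
    show "env (fenchel_conj g) x - env (fenchel_conj f) x = env f x - env g x"
      by (simp add: env_fenchel_conj assms a b)
  qed
  define h where "h x = real_of_ereal (env f x) - real_of_ereal (env g x)" for x
  have h: "ereal (h x) = env f x - env g x" for x
    unfolding h_def using ereal_real_of_env[OF assms(1), of x] ereal_real_of_env[OF assms(2), of x]
    by (metis ereal_minus(1))
  have grad: "GDERIV h x :> prox g x - prox f x" for x
    unfolding h_def[abs_def]
    by (rule GDERIV_subst[OF GDERIV_diff[OF env_GDERIV[OF assms(1)] env_GDERIV[OF assms(2)]]]) simp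
  have "(\<lambda>x. prox g x - prox f x) \<in> prox_maps" "(\<lambda>x. env f x - env g x) \<in> M0"
    if fne: "prox f \<preceq>\<^sub>R prox g"
  proof -
    obtain k where k: "k \<in> Gamma0" "\<And>x. env k x = ereal (h x)"
        "\<And>x. prox k x = x - (prox g x - prox f x)"
      using firmly_nonexpansive_gradient_is_env[OF grad] fne unfolding resolvent_le_def by blast
    have "prox (fenchel_conj k) = (\<lambda>x. prox g x - prox f x)"
      by (rule ext) (simp add: prox_fenchel_conj k)
    then show "(\<lambda>x. prox g x - prox f x) \<in> prox_maps"
      unfolding prox_maps_def using fenchel_conj_in_Gamma0[OF k(1)] by (metis imageI)
    have "env k = (\<lambda>x. env f x - env g x)" by (rule ext) (simp add: k h)
    then show "(\<lambda>x. env f x - env g x) \<in> M0"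
      unfolding M0_def using k(1) by (metis imageI)
  qed
  moreover have "prox f \<preceq>\<^sub>R prox g" if "(\<lambda>x. prox g x - prox f x) \<in> prox_maps"
    using that prox_firmly_nonexpansive unfolding prox_maps_def resolvent_le_def by auto
  moreover have "prox f \<preceq>\<^sub>R prox g" if M: "(\<lambda>x. env f x - env g x) \<in> M0"
  proof -
    obtain k where k: "k \<in> Gamma0" "(\<lambda>x. env f x - env g x) = env k"
      using M unfolding M0_def by blast
    have "h x = real_of_ereal (env k x)" for x
      using h[of x] fun_cong[OF k(2), of x] by (metis real_of_ereal.simps(1))
    then have "GDERIV h x :> x - prox k x" for x
      using env_GDERIV[OF k(1), of x] by presburger
    then have "prox g x - prox f x = prox (fenchel_conj k) x" for x
      using GDERIV_unique[OF grad] by (simp add: prox_fenchel_conj[OF k(1)])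
    then show ?thesis
      unfolding resolvent_le_def
      using prox_firmly_nonexpansive[OF fenchel_conj_in_Gamma0[OF k(1)]] by simp
  qed
  ultimately show ?thesis unfolding conj_diff by blast
qed

end
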